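(* Let $x\in(0,1]$ and let $w\in\Omega_n(x)$ with $n\in\mathbb{N}$. Then for any $\beta>\underline{\beta}(w)\ge1$, one has $w\in\Sigma_n(\beta)$. In particular, if $u$ is a prefix of $w$, then $w\in\Sigma_n(\overline{\beta}(u))$.
   Context: $\mathbb{N}=\{1,2,\dots\}$. For $\beta>1$ let $T_\beta(y)=\beta y-\lfloor\beta y\rfloor$ on $[0,1]$ and $\varepsilon_n(y,\beta)=\lfloor\beta T_\beta^{n-1}y\rfloor$ for $n\ge1$. Let $\Sigma_n(\beta)=\{\varepsilon_1(y,\beta)\cdots\varepsilon_n(y,\beta)\colon y\in[0,1)\}$. For fixed $x\in(0,1]$ let $\Omega_n(x)=\{\varepsilon_1(x,\beta)\cdots\varepsilon_n(x,\beta)\colon\beta>1\}$. For $w=w_1\cdots w_n\in\Omega_n(x)$: $\underline{\beta}(w)=1$ if $w=0^n$; otherwise $\underline{\beta}(w)\ge1$ is the unique positive solution $\beta$ of $x=\sum_{i=1}^n w_i\beta^{-i}$. For $k\in\mathbb{N}$ let $w^{(k)}$ be the lexicographically largest word in $\Omega_{n+k}(x)$ having $w$ as a prefix; $\overline{\beta}(w)=\lim_{k\to\infty}\underline{\beta}(w^{(k)})$ (the limit exists and $\overline{\beta}(w)>\underline{\beta}(w)$). A prefix of $w$ is a word $u=w_1\cdots w_m$ with $1\le m\le n$ (so $u\in\Omega_m(x)$). *)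

theory Defs
  imports Complex_Main "HOL-Library.Sublist" "HOL-Library.List_Lexorder"
begin

definition T_beta :: "real \<Rightarrow> real \<Rightarrow> real" where
  "T_beta \<beta> y = \<beta> * y - of_int \<lfloor>\<beta> * y\<rfloor>"

text \<open>Digits, and hence the entries of a word, are indexed from 1 as in the mathematical notation;
  the letter $w_i$ of a word is the list entry \<open>w ! (i - 1)\<close>.\<close>

definition digit :: "nat \<Rightarrow> real \<Rightarrow> real \<Rightarrow> int" where
  "digit n y \<beta> = \<lfloor>\<beta> * (T_beta \<beta> ^^ (n - 1)) y\<rfloor>"

definition digit_word :: "nat \<Rightarrow> real \<Rightarrow> real \<Rightarrow> int list" where
  "digit_word n y \<beta> = map (\<lambda>i. digit i y \<beta>) [1..<n + 1]"

definition Sigma_words :: "nat \<Rightarrow> real \<Rightarrow> int list set" where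
  "Sigma_words n \<beta> = {digit_word n y \<beta> | y. 0 \<le> y \<and> y < 1}"

definition Omega_words :: "nat \<Rightarrow> real \<Rightarrow> int list set" where
  "Omega_words n x = {digit_word n x \<beta> | \<beta>. \<beta> > 1}"

definition beta_lower :: "real \<Rightarrow> int list \<Rightarrow> real" where
  "beta_lower x w =
    (if w = replicate (length w) 0 then 1
     else (THE \<beta>. \<beta> > 0 \<and> x = (\<Sum>i=1..length w. of_int (w ! (i - 1)) / \<beta> ^ i)))"

text \<open>The order on \<open>int list\<close> is the lexicographic one. For nonempty words \<open>w\<close> in
  \<open>Omega_words (length w) x\<close> with \<open>0 < x\<close>, the first digit bounds the base, so only finitely
  many words compete for the maximum.\<close>

definition max_ext :: "real \<Rightarrow> int list \<Rightarrow> nat \<Rightarrow> int list" where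
  "max_ext x w k = (GREATEST v. v \<in> Omega_words (length w + k) x \<and> prefix w v)"

definition beta_upper :: "real \<Rightarrow> int list \<Rightarrow> real" where
  "beta_upper x w = lim (\<lambda>k. beta_lower x (max_ext x w k))"

end

theory Submission
  imports Defs
begin

text \<open>
  Fix \<open>w = w\<^sub>1\<dots>w\<^sub>n\<close> and follow the greedy algorithm for \<open>x\<close> with the digits of \<open>w\<close> prescribed:
  after \<open>k\<close> steps it leaves the remainder \<open>\<beta>\<^sup>k (x - (w\<^sub>1/\<beta> + \<dots> + w\<^sub>k/\<beta>\<^sup>k))\<close>. The word of the first \<open>n\<close>
  digits of \<open>x\<close> in base \<open>\<beta>\<close> is \<open>w\<close> if and only if the remainders number \<open>1\<close> to \<open>n\<close> all lie in
  \<open>[0,1)\<close> (\<open>digit_word_eq_iff\<close>), and as long as remainders are nonnegative they grow with \<open>\<beta>\<close>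
  (\<open>remainder_gap\<close>). Everything is derived from these two facts.

  Suppose that \<open>w\<close> is the digit word of \<open>x\<close> in base \<open>\<beta>\<^sub>0\<close>, and let \<open>\<beta>\<close> exceed the lower end point
  \<open>beta_lower x w\<close>. The point \<open>y = w\<^sub>1/\<beta> + \<dots> + w\<^sub>n/\<beta>\<^sup>n\<close> then satisfies \<open>0 \<le> y < x \<le> 1\<close>, and its
  remainders along \<open>w\<close> are the tails \<open>w\<^sub>k\<^sub>+\<^sub>1/\<beta> + \<dots> + w\<^sub>n/\<beta>\<^sup>n\<^sup>-\<^sup>k \<ge> 0\<close>, so only the bound by \<open>1\<close> is at stake.
  If \<open>\<beta> \<le> \<beta>\<^sub>0\<close>, the remainders of \<open>y\<close> are at most those of \<open>x\<close> in base \<open>\<beta>\<close>, which by monotonicity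
  are at most those of \<open>x\<close> in base \<open>\<beta>\<^sub>0\<close>, which are below \<open>1\<close>. If \<open>\<beta> > \<beta>\<^sub>0\<close>, the tails decrease in \<open>\<beta>\<close>,
  so they are bounded by the tails, and hence by the remainders of \<open>x\<close>, in base \<open>\<beta>\<^sub>0\<close>. Thus \<open>w\<close> is the
  digit word of \<open>y\<close> in base \<open>\<beta>\<close> (\<open>word_in_Sigma_words_above_beta_lower\<close>).

  For the statement on prefixes \<open>u\<close>, it remains to see that \<open>beta_lower x w < beta_upper x u\<close>.
  Here \<open>beta_upper x u\<close> is the supremum of the bases in which the digit word of \<open>x\<close> begins with \<open>u\<close>
  (\<open>beta_upper_eq_Sup_cylinder\<close>): digit words increase lexicographically with the base, so
  the largest extensions of \<open>u\<close> come from the right end of this set of bases, and the set of bases of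
  a word of length \<open>N\<close> shrinks exponentially in \<open>N\<close> because differing bases make the remainders
  drift apart exponentially while they are confined to \<open>[0,1)\<close>. Finally \<open>beta_lower x w \<le> \<beta>\<^sub>0\<close>,
  and a base slightly larger than \<open>\<beta>\<^sub>0\<close> still produces \<open>w\<close> (\<open>cylinder_right_open\<close>), so
  \<open>\<beta>\<^sub>0\<close> lies strictly below that supremum.
\<close>

section \<open>Remainders and digit words\<close>

text \<open>The orbit of \<open>x\<close> under \<open>y \<mapsto> \<beta>y - d\<close> with the digits \<open>d\<close> read from a given word instead
  of being computed from \<open>\<beta>\<close>; as a function of \<open>\<beta>\<close> it is therefore a polynomial.\<close>

primrec remainder :: "real \<Rightarrow> int list \<Rightarrow> real \<Rightarrow> nat \<Rightarrow> real" where
  "remainder x w \<beta> 0 = x"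
| "remainder x w \<beta> (Suc k) = \<beta> * remainder x w \<beta> k - of_int (w ! k)"

definition partial_expansion :: "int list \<Rightarrow> real \<Rightarrow> nat \<Rightarrow> real" where
  "partial_expansion w \<beta> k = (\<Sum>i=1..k. of_int (w ! (i - 1)) / \<beta> ^ i)"

abbreviation expansion :: "int list \<Rightarrow> real \<Rightarrow> real" where
  "expansion w \<beta> \<equiv> partial_expansion w \<beta> (length w)"

lemma remainder_eq:
  assumes "\<beta> > 0"
  shows "remainder x w \<beta> k = \<beta> ^ k * (x - partial_expansion w \<beta> k)"
proof (induction k)
  case (Suc k)
  have step: "partial_expansion w \<beta> (Suc k) = partial_expansion w \<beta> k + of_int (w ! k) / \<beta> ^ Suc k"
    by (simp add: partial_expansion_def)
  then show ?case unfolding remainder.simps Suc step using assms by (simp add: field_simps)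
qed (simp add: partial_expansion_def)

lemma length_digit_word [simp]: "length (digit_word n y \<beta>) = n"
  by (simp add: digit_word_def)

lemma nth_digit_word: "k < n \<Longrightarrow> digit_word n y \<beta> ! k = \<lfloor>\<beta> * (T_beta \<beta> ^^ k) y\<rfloor>"
  by (simp add: digit_word_def digit_def del: upt_Suc)

lemma take_digit_word: "m \<le> n \<Longrightarrow> take m (digit_word n y \<beta>) = digit_word m y \<beta>"
  by (rule nth_equalityI) (simp_all add: nth_digit_word)

lemma remainder_digit_word:
  "k \<le> n \<Longrightarrow> remainder y (digit_word n y \<beta>) \<beta> k = (T_beta \<beta> ^^ k) y"
  by (induction k) (simp_all add: nth_digit_word T_beta_def)

text \<open>An integer \<open>d\<close> equals \<open>\<lfloor>\<beta>r\<rfloor>\<close> exactly when \<open>\<beta>r - d\<close> lies in \<open>[0,1)\<close>, so a wrong prescribed digit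
  is detected by the next remainder. The remainder number \<open>0\<close>, which is \<open>y\<close> itself, is exempt: this
  admits \<open>y = 1\<close>.\<close>

lemma digit_word_eq_iff:
  "digit_word n y \<beta> = w \<longleftrightarrow>
    length w = n \<and> (\<forall>k\<in>{1..n}. 0 \<le> remainder y w \<beta> k \<and> remainder y w \<beta> k < 1)"
proof
  assume w: "digit_word n y \<beta> = w"
  have "0 \<le> remainder y w \<beta> k \<and> remainder y w \<beta> k < 1" if k: "k \<in> {1..n}" for k
  proof -
    obtain j where j: "k = Suc j" using k by (cases k) auto
    have "remainder y w \<beta> k = T_beta \<beta> ((T_beta \<beta> ^^ j) y)"
      using remainder_digit_word[of k n y \<beta>] k w j by simp
    then show ?thesis unfolding T_beta_def by linarith
  qed
  then show "length w = n \<and> (\<forall>k\<in>{1..n}. 0 \<le> remainder y w \<beta> k \<and> remainder y w \<beta> k < 1)"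
    using w by auto
next
  assume *: "length w = n \<and> (\<forall>k\<in>{1..n}. 0 \<le> remainder y w \<beta> k \<and> remainder y w \<beta> k < 1)"
  have digit_eq: "\<lfloor>\<beta> * remainder y w \<beta> k\<rfloor> = w ! k" if "k < n" for k
  proof -
    have "0 \<le> remainder y w \<beta> (Suc k)" "remainder y w \<beta> (Suc k) < 1"
      using bspec[OF conjunct2[OF *], of "Suc k"] that by (simp_all del: remainder.simps)
    then show ?thesis by (simp add: floor_eq_iff)
  qed
  have orbit: "(T_beta \<beta> ^^ k) y = remainder y w \<beta> k" if "k \<le> n" for k
    using that by (induction k) (simp_all add: T_beta_def digit_eq)
  show "digit_word n y \<beta> = w"
    by (rule nth_equalityI) (simp_all add: * nth_digit_word orbit digit_eq)
qed

lemma digit_word_remainder: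
  assumes "k \<le> n" and "0 \<le> y"
  shows "0 \<le> remainder y (digit_word n y \<beta>) \<beta> k"
  using assms digit_word_eq_iff[of n y \<beta> "digit_word n y \<beta>"] by (cases "k = 0") auto

lemma digit_word_nonneg:
  assumes "0 \<le> y" and "0 < \<beta>" and "k < n"
  shows "0 \<le> digit_word n y \<beta> ! k"
  using digit_word_remainder[of k n y \<beta>] remainder_digit_word[of k n y \<beta>] assms
  by (simp add: nth_digit_word)

section \<open>Dependence on the base\<close>

text \<open>A difference between two bases is multiplied by \<open>\<beta>'\<close> at every step, since
  \<open>\<beta>'r' - \<beta>r = \<beta>'(r' - r) + (\<beta>' - \<beta>)r\<close> and the last term is nonnegative. The gap created by the
  first step is \<open>(\<beta>' - \<beta>)x\<close>.\<close>

lemma remainder_gap: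
  assumes "0 < \<beta>" and "\<beta> \<le> \<beta>'" and "\<And>j. j \<le> k \<Longrightarrow> 0 \<le> remainder x w \<beta> j"
  shows "remainder x w \<beta> (Suc k) + \<beta>' ^ k * (\<beta>' - \<beta>) * x \<le> remainder x w \<beta>' (Suc k)"
  using assms(3)
proof (induction k)
  case 0
  then show ?case by (simp add: algebra_simps)
next
  case (Suc k)
  let ?r = "remainder x w \<beta> (Suc k)" and ?r' = "remainder x w \<beta>' (Suc k)"
  have "?r + \<beta>' ^ k * (\<beta>' - \<beta>) * x \<le> ?r'" using Suc by simp
  then have "\<beta>' * (?r + \<beta>' ^ k * (\<beta>' - \<beta>) * x) \<le> \<beta>' * ?r'"
    using assms(1,2) by (intro mult_left_mono) auto
  moreover have "\<beta> * ?r \<le> \<beta>' * ?r"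
    using assms(2) Suc.prems[of "Suc k"] by (intro mult_right_mono) auto
  ultimately show ?case
    unfolding remainder.simps(2)[of x w _ "Suc k"] by (simp add: algebra_simps)
qed

lemma remainder_mono_base:
  assumes "0 < \<beta>" and "\<beta> \<le> \<beta>'" and "\<And>j. j < k \<Longrightarrow> 0 \<le> remainder x w \<beta> j"
  shows "remainder x w \<beta> k \<le> remainder x w \<beta>' k"
proof (cases k)
  case (Suc l)
  then have "0 \<le> x" using assms(3)[of 0] by simp
  then have "0 \<le> \<beta>' ^ l * (\<beta>' - \<beta>) * x" using assms(1,2) by simp
  then show ?thesis
    using remainder_gap[of \<beta> \<beta>' l x w] assms Suc by (simp add: less_Suc_eq_le)
qed simp

text \<open>Up to the first place where two digit words differ, both orbits read the same prescribed digits,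
  so the orbit in the larger base is ahead there and produces the larger digit.\<close>

lemma digit_word_mono_base:
  assumes "0 \<le> x" and "0 < \<beta>" and "\<beta> \<le> \<beta>'"
  shows "digit_word n x \<beta> \<le> digit_word n x \<beta>'"
proof (rule ccontr)
  let ?w = "digit_word n x \<beta>" and ?w' = "digit_word n x \<beta>'"
  assume "\<not> ?w \<le> ?w'"
  then have "(?w', ?w) \<in> lexord {(a, b). a < b}"
    by (simp add: not_le list_less_def)
  then obtain i where i: "i < n" "take i ?w' = take i ?w" "?w' ! i < ?w ! i"
    by (auto simp: lexord_take_index_conv)
  have "?w ! j = ?w' ! j" if "j < i" for j
    using i(2) that by (metis nth_take)
  then have "remainder x ?w' \<beta>' k = remainder x ?w \<beta>' k" if "k \<le> i" for k
    using that by (induction k) auto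
  then have "remainder x ?w \<beta> i \<le> remainder x ?w' \<beta>' i"
    using remainder_mono_base[of \<beta> \<beta>' i x ?w] digit_word_remainder[of _ n x \<beta>] assms i(1) by simp
  then have "\<beta> * remainder x ?w \<beta> i \<le> \<beta>' * remainder x ?w' \<beta>' i"
    using assms digit_word_remainder[of i n x \<beta>] i(1) by (intro mult_mono) auto
  then have "?w ! i \<le> ?w' ! i"
    using i(1) by (simp add: nth_digit_word remainder_digit_word floor_mono)
  with i(3) show False by simp
qed

text \<open>Enlarging the base cannot violate the lower bound \<open>0\<close> for the remainders, by monotonicity, and the
  upper bound \<open>1\<close> is a strict inequality between continuous functions.\<close>

lemma cylinder_right_open:
  assumes "0 \<le> x" and "0 < \<beta>"
  obtains \<beta>' where "\<beta> < \<beta>'" and "digit_word n x \<beta>' = digit_word n x \<beta>"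
proof -
  let ?w = "digit_word n x \<beta>"
  have "continuous_on UNIV (\<lambda>b. remainder x ?w b k)" for k
    by (induction k) (auto intro!: continuous_intros)
  then have "((\<lambda>b. remainder x ?w b k) \<longlongrightarrow> remainder x ?w \<beta> k) (at_right \<beta>)" for k
    by (auto simp: continuous_on_def intro: tendsto_within_subset)
  then have "\<forall>\<^sub>F b in at_right \<beta>. remainder x ?w b k < 1" if "k \<in> {1..n}" for k
    using that digit_word_eq_iff[of n x \<beta> ?w] order_tendstoD(2) by fastforce
  then have "\<forall>\<^sub>F b in at_right \<beta>. \<forall>k\<in>{1..n}. remainder x ?w b k < 1"
    by (intro eventually_ball_finite) auto
  moreover have "\<forall>\<^sub>F b in at_right \<beta>. \<beta> < b"
    by (simp add: eventually_at_right_less)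
  ultimately have "\<forall>\<^sub>F b in at_right \<beta>. \<beta> < b \<and> (\<forall>k\<in>{1..n}. remainder x ?w b k < 1)"
    by eventually_elim auto
  then obtain b where b: "\<beta> < b" "\<forall>k\<in>{1..n}. remainder x ?w b k < 1"
    using eventually_happens' trivial_limit_at_right_real by blast
  have "0 \<le> remainder x ?w b k" if "k \<in> {1..n}" for k
  proof -
    have "remainder x ?w \<beta> k \<le> remainder x ?w b k"
      using that assms b(1) digit_word_remainder by (intro remainder_mono_base) auto
    then show ?thesis
      using digit_word_remainder[of k n x \<beta>] that assms(1) by auto
  qed
  then have "digit_word n x b = ?w" using b(2) by (simp add: digit_word_eq_iff)
  with b(1) that show thesis by blast
qed

section \<open>The lower end point of a cylinder\<close>

lemma partial_expansion_mono:
  assumes "0 < \<beta>" and "k \<le> n" and "\<And>i. i < n \<Longrightarrow> 0 \<le> w ! i"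
  shows "partial_expansion w \<beta> k \<le> partial_expansion w \<beta> n"
  unfolding partial_expansion_def using assms by (intro sum_mono2) auto

lemma expansion_strict_antimono:
  assumes "0 < \<beta>" and "\<beta> < \<beta>'" and nonneg: "\<And>i. i < length w \<Longrightarrow> 0 \<le> w ! i"
    and "w \<noteq> replicate (length w) 0"
  shows "expansion w \<beta>' < expansion w \<beta>"
proof -
  obtain j where j: "j < length w" "w ! j \<noteq> 0"
    using assms(4) by (metis length_replicate nth_equalityI nth_replicate)
  have "0 < real_of_int (w ! j)" using j nonneg[of j] by simp
  then have "real_of_int (w ! j) / \<beta>' ^ Suc j < of_int (w ! j) / \<beta> ^ Suc j"
    using assms(1,2) by (intro divide_strict_left_mono power_strict_mono) auto
  moreover have "real_of_int (w ! (i - 1)) / \<beta>' ^ i \<le> of_int (w ! (i - 1)) / \<beta> ^ i"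
    if "i \<in> {1..length w}" for i
    using that assms(1,2) nonneg[of "i - 1"] by (intro divide_left_mono power_mono) auto
  ultimately show ?thesis
    unfolding partial_expansion_def using j(1)
    by (intro sum_strict_mono_ex1) (auto intro!: bexI[of _ "Suc j"])
qed

lemma expansion_zero_word:
  assumes "w = replicate (length w) 0"
  shows "expansion w \<beta> = 0"
proof -
  have "w ! i = 0" if "i < length w" for i
    using that assms by (metis nth_replicate)
  then show ?thesis unfolding partial_expansion_def by (intro sum.neutral) auto
qed

lemma expansion_digit_word_le:
  assumes "0 \<le> x" and "0 < \<beta>"
  shows "expansion (digit_word n x \<beta>) \<beta> \<le> x"
  using digit_word_remainder[of n n x \<beta>] assms
  by (auto simp: remainder_eq zero_le_mult_iff power_le_zero_eq)

text \<open>These four properties are all that is used of \<open>beta_lower\<close>, and they treat the zero word like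
  any other word. For a nonzero word the expansion is at least \<open>1 \<ge> x\<close> in base \<open>1\<close>, being the sum of
  the digits, and at most \<open>x\<close> in base \<open>\<beta>\<close>; it decreases strictly, so the equation defining
  \<open>beta_lower\<close> has exactly one solution, and this lies in \<open>[1,\<beta>]\<close>.\<close>

lemma expansion_beta_lower:
  assumes "0 < x" and "x \<le> 1" and "1 < \<beta>" and w: "w = digit_word n x \<beta>"
  shows "1 \<le> beta_lower x w" and "beta_lower x w \<le> \<beta>"
    and "expansion w (beta_lower x w) \<le> x"
    and "beta_lower x w < b \<Longrightarrow> expansion w b < x"
proof -
  have "1 \<le> beta_lower x w \<and> beta_lower x w \<le> \<beta> \<and> expansion w (beta_lower x w) \<le> x
    \<and> (\<forall>b > beta_lower x w. expansion w b < x)"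
  proof (cases "w = replicate (length w) 0")
    case True
    have "beta_lower x w = 1" unfolding beta_lower_def by (rule if_P[OF True])
    then show ?thesis
      using assms(1,3) expansion_zero_word[OF True] by simp
  next
    case False
    have nonneg: "0 \<le> w ! i" if "i < length w" for i
      using that w digit_word_nonneg[of x \<beta> i n] assms(1,3) by simp
    obtain j where j: "j < length w" "w ! j \<noteq> 0"
      using False by (metis length_replicate nth_equalityI nth_replicate)
    have "x \<le> real_of_int (w ! (Suc j - 1)) / 1 ^ Suc j"
      using nonneg[of j] j assms(2) by simp
    also have "\<dots> \<le> expansion w 1"
      unfolding partial_expansion_def using j(1) nonneg by (intro member_le_sum) auto
    finally have at_1: "x \<le> expansion w 1" .
    have at_base: "expansion w \<beta> \<le> x"
      using expansion_digit_word_le[of x \<beta> n] assms(1,3) w by simp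
    have "continuous_on {1..\<beta>} (\<lambda>b. expansion w b)"
      unfolding partial_expansion_def by (intro continuous_intros) auto
    then obtain c where c: "1 \<le> c" "c \<le> \<beta>" "expansion w c = x"
      using IVT2'[of "\<lambda>b. expansion w b" \<beta> x 1, OF at_base at_1] assms(3) by force
    have decreasing: "expansion w b' < expansion w b" if "0 < b" "b < b'" for b b'
      using that nonneg False by (rule expansion_strict_antimono)
    have unique: "b = c" if "0 < b" "x = expansion w b" for b
      using decreasing[of b c] decreasing[of c b] that c(1,3) by linarith
    have "(THE b. 0 < b \<and> x = expansion w b) = c"
    proof (rule the_equality)
      show "0 < c \<and> x = expansion w c" using c by simp
    qed (use unique in blast)
    then have "beta_lower x w = c"
      unfolding beta_lower_def if_not_P[OF False] partial_expansion_def .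
    then show ?thesis using c decreasing[of c] by simp
  qed
  then show "1 \<le> beta_lower x w" "beta_lower x w \<le> \<beta>"
    "expansion w (beta_lower x w) \<le> x" "beta_lower x w < b \<Longrightarrow> expansion w b < x"
    by auto
qed

text \<open>Digits are nonnegative, so the partial sums of the expansion are bounded by the whole
  expansion, which is at most \<open>x\<close> from the lower end point on.\<close>

lemma remainder_nonneg_above_beta_lower:
  assumes "0 < x" and "x \<le> 1" and "1 < \<beta>" and w: "w = digit_word n x \<beta>"
    and "beta_lower x w \<le> b" and "k \<le> n"
  shows "0 \<le> remainder x w b k"
proof -
  have b: "0 < b" using expansion_beta_lower(1)[OF assms(1-4)] assms(5) by simp
  have "0 \<le> w ! i" if "i < n" for i
    using that w digit_word_nonneg[of x \<beta> i n] assms(1,3) by simp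
  then have "partial_expansion w b k \<le> expansion w b"
    using partial_expansion_mono[of b k n w] b assms(6) w by simp
  also have "\<dots> \<le> x"
  proof (cases "b = beta_lower x w")
    case True
    then show ?thesis using expansion_beta_lower(3)[OF assms(1-4)] by simp
  next
    case False
    then show ?thesis
      using expansion_beta_lower(4)[OF assms(1-4), of b] assms(5) by linarith
  qed
  finally show ?thesis using b by (simp add: remainder_eq)
qed

lemma remainder_less_1_up_to_base:
  assumes "0 < x" and "x \<le> 1" and "1 < \<beta>" and w: "w = digit_word n x \<beta>"
    and "beta_lower x w \<le> b" and "b \<le> \<beta>" and "k \<in> {1..n}"
  shows "remainder x w b k < 1"
proof -
  have "remainder x w b k \<le> remainder x w \<beta> k"
  proof (rule remainder_mono_base)
    show "0 < b" using expansion_beta_lower(1)[OF assms(1-4)] assms(5) by linarith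
    show "0 \<le> remainder x w b j" if "j < k" for j
      using remainder_nonneg_above_beta_lower[OF assms(1-5)] assms(7) that by simp
  qed (rule assms(6))
  also have "\<dots> < 1"
    using iffD1[OF digit_word_eq_iff w[symmetric]] assms(7) by blast
  finally show ?thesis .
qed

lemma digit_word_between_beta_lower_and_base:
  assumes "0 < x" and "x \<le> 1" and "1 < \<beta>" and "w = digit_word n x \<beta>"
    and "beta_lower x w \<le> b" and "b \<le> \<beta>"
  shows "digit_word n x b = w"
  unfolding digit_word_eq_iff
proof (intro conjI ballI)
  show "length w = n" using assms(4) by simp
  fix k assume k: "k \<in> {1..n}"
  then show "0 \<le> remainder x w b k"
    using remainder_nonneg_above_beta_lower[OF assms(1-5)] by simp
  show "remainder x w b k < 1" by (rule remainder_less_1_up_to_base[OF assms k])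
qed

section \<open>Admissibility above the lower end point\<close>

text \<open>Starting at the value of the word itself, the algorithm leaves the value of the unread part of
  the word.\<close>

lemma remainder_expansion:
  assumes "0 < b" and "k \<le> length w"
  shows "remainder (expansion w b) w b k = (\<Sum>i\<in>{k<..length w}. of_int (w ! (i - 1)) / b ^ (i - k))"
proof -
  have "{1..length w} = {1..k} \<union> {k<..length w}" "{1..k} \<inter> {k<..length w} = {}"
    using assms(2) by auto
  then have "expansion w b - partial_expansion w b k
      = (\<Sum>i\<in>{k<..length w}. of_int (w ! (i - 1)) / b ^ i)"
    unfolding partial_expansion_def by (simp add: sum.union_disjoint)
  then have "remainder (expansion w b) w b k
      = (\<Sum>i\<in>{k<..length w}. b ^ k * (of_int (w ! (i - 1)) / b ^ i))"
    using assms(1) by (simp add: remainder_eq sum_distrib_left)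
  also have "\<dots> = (\<Sum>i\<in>{k<..length w}. of_int (w ! (i - 1)) / b ^ (i - k))"
    using assms(1) by (intro sum.cong) (auto simp: power_diff)
  finally show ?thesis .
qed

text \<open>The witness is the value of \<open>w\<close> in base \<open>b\<close>, the least point whose digits can be \<open>w\<close>. Below \<open>\<beta>\<close>
  its remainders are controlled by those of \<open>x\<close> in the same base, above \<open>\<beta>\<close> by its own remainders in
  base \<open>\<beta>\<close>.\<close>

lemma word_in_Sigma_words_above_beta_lower:
  assumes "0 < x" and "x \<le> 1" and "1 < \<beta>" and w: "w = digit_word n x \<beta>"
    and b: "beta_lower x w < b"
  shows "w \<in> Sigma_words n b"
  unfolding Sigma_words_def mem_Collect_eq
proof (intro exI conjI)
  let ?y = "expansion w b"
  have len: "length w = n" using w by simp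
  have "1 \<le> beta_lower x w" by (rule expansion_beta_lower[OF assms(1-4)])
  then have b1: "1 < b" using b by simp
  have nonneg: "0 \<le> w ! i" if "i < n" for i
    using that w digit_word_nonneg[of x \<beta> i n] assms(1,3) by simp
  have "?y < x" using expansion_beta_lower(4)[OF assms(1-4)] b by simp
  then have y1: "?y < 1" using assms(2) by simp
  have rem0: "0 \<le> remainder ?y w b k" if "k \<le> n" for k
    using that b1 nonneg len by (auto simp: remainder_expansion intro!: sum_nonneg)
  have rem1: "remainder ?y w b k < 1" if k: "k \<in> {1..n}" for k
  proof (cases "b \<le> \<beta>")
    case True
    have "remainder ?y w b k \<le> remainder x w b k"
      using \<open>?y < x\<close> b1 by (simp add: remainder_eq)
    also have "\<dots> < 1"
      using remainder_less_1_up_to_base[OF assms(1-4)] b True k by simp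
    finally show ?thesis .
  next
    case False
    have "remainder ?y w b k \<le> remainder (expansion w \<beta>) w \<beta> k"
      using False assms(3) k nonneg len
      by (auto simp: remainder_expansion intro!: sum_mono divide_left_mono power_mono)
    also have "\<dots> \<le> remainder x w \<beta> k"
      using expansion_digit_word_le[of x \<beta> n] assms(1,3) w by (simp add: remainder_eq)
    also have "\<dots> < 1"
      using iffD1[OF digit_word_eq_iff w[symmetric]] k by blast
    finally show ?thesis .
  qed
  have "digit_word n ?y b = w"
    unfolding digit_word_eq_iff using len rem0 rem1 by (intro conjI ballI) simp_all
  then show "w = digit_word n ?y b" by (rule sym)
  show "0 \<le> ?y" using rem0[of 0] by simp
  show "?y < 1" by (rule y1)
qed

section \<open>The upper end point of a cylinder\<close>

definition cylinder :: "real \<Rightarrow> int list \<Rightarrow> real set" where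
  "cylinder x u = {\<beta>. 1 < \<beta> \<and> digit_word (length u) x \<beta> = u}"

lemma prefix_digit_word_iff:
  "prefix u (digit_word (length u + k) x \<beta>) \<longleftrightarrow> digit_word (length u) x \<beta> = u"
  by (metis append_eq_conv_conj le_add1 prefix_def take_digit_word take_is_prefix)

lemma cylinder_less:
  assumes "0 < x" and "u \<noteq> []" and "\<beta> \<in> cylinder x u"
  shows "\<beta> < (of_int (hd u) + 1) / x"
proof -
  have "hd u = \<lfloor>\<beta> * x\<rfloor>"
    using assms(2,3) nth_digit_word[of 0 "length u" x \<beta>]
    by (auto simp: cylinder_def hd_conv_nth)
  then have "\<beta> * x < of_int (hd u) + 1" by linarith
  then show ?thesis using assms(1) by (simp add: field_simps)
qed

lemma bdd_above_cylinder: "0 < x \<Longrightarrow> u \<noteq> [] \<Longrightarrow> bdd_above (cylinder x u)"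
  using cylinder_less by (meson bdd_aboveI less_imp_le)

text \<open>The digits are at most the base, which the first letter of \<open>u\<close> bounds. Finiteness is what makes
  the lexicographic maximum in the definition of \<open>max_ext\<close> exist.\<close>

lemma finite_extensions:
  assumes "0 < x" and "x \<le> 1" and "u \<noteq> []"
  shows "finite {v \<in> Omega_words (length u + k) x. prefix u v}"
proof -
  let ?M = "(of_int (hd u) + 1) / x"
  have "set v \<subseteq> {0..\<lfloor>?M\<rfloor>} \<and> length v = length u + k"
    if "v \<in> Omega_words (length u + k) x" "prefix u v" for v
  proof -
    let ?n = "length u + k"
    obtain \<beta> where \<beta>: "1 < \<beta>" "v = digit_word ?n x \<beta>"
      using \<open>v \<in> Omega_words ?n x\<close> by (auto simp: Omega_words_def)
    then have "\<beta> \<in> cylinder x u"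
      using \<open>prefix u v\<close> by (simp add: cylinder_def prefix_digit_word_iff)
    then have less: "\<beta> < ?M" by (rule cylinder_less[OF assms(1,3)])
    have "v ! i \<in> {0..\<lfloor>?M\<rfloor>}" if i: "i < ?n" for i
    proof -
      have "remainder x v \<beta> i \<le> 1"
      proof (cases "i = 0")
        case True
        then show ?thesis using assms(2) by simp
      next
        case False
        then have "i \<in> {1..?n}" using i by simp
        then show ?thesis
          using iffD1[OF digit_word_eq_iff \<beta>(2)[symmetric]] less_imp_le by blast
      qed
      then have "\<beta> * remainder x v \<beta> i \<le> \<beta> * 1"
        using \<beta>(1) by (intro mult_left_mono) auto
      then have "\<beta> * remainder x v \<beta> i \<le> ?M" using less by linarith
      then have "v ! i \<le> \<lfloor>?M\<rfloor>"
        using \<beta>(2) i by (simp add: nth_digit_word remainder_digit_word floor_mono)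
      moreover have "0 \<le> v ! i" using digit_word_nonneg[of x \<beta> i ?n] assms(1) \<beta> i by simp
      ultimately show ?thesis by simp
    qed
    then show ?thesis using \<beta>(2) by (fastforce simp: in_set_conv_nth)
  qed
  then have "{v \<in> Omega_words (length u + k) x. prefix u v}
      \<subseteq> {v. set v \<subseteq> {0..\<lfloor>?M\<rfloor>} \<and> length v = length u + k}"
    by blast
  then show ?thesis using finite_lists_length_eq finite_subset by blast
qed

lemma max_ext_greatest:
  assumes "0 < x" and "x \<le> 1" and "u \<noteq> []" and "\<beta> \<in> cylinder x u"
  obtains \<beta>' where "\<beta>' \<in> cylinder x u" and "max_ext x u k = digit_word (length u + k) x \<beta>'"
    and "digit_word (length u + k) x \<beta> \<le> max_ext x u k"
proof -
  let ?E = "{v \<in> Omega_words (length u + k) x. prefix u v}"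
  have fin: "finite ?E" by (rule finite_extensions[OF assms(1-3)])
  have \<beta>E: "digit_word (length u + k) x \<beta> \<in> ?E"
    using assms(4) by (auto simp: cylinder_def Omega_words_def prefix_digit_word_iff)
  have "max_ext x u k = Max ?E"
    unfolding max_ext_def
  proof (rule Greatest_equality)
    show "Max ?E \<in> Omega_words (length u + k) x \<and> prefix u (Max ?E)"
      using Max_in[OF fin] \<beta>E by blast
  qed (use fin in auto)
  then have "max_ext x u k \<in> ?E" and le: "digit_word (length u + k) x \<beta> \<le> max_ext x u k"
    using Max_in[OF fin] Max_ge[OF fin \<beta>E] \<beta>E by auto
  then obtain \<beta>' where "1 < \<beta>'" "max_ext x u k = digit_word (length u + k) x \<beta>'"
    "prefix u (max_ext x u k)"
    by (auto simp: Omega_words_def)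
  then show thesis
    using that[of \<beta>'] le by (simp add: cylinder_def prefix_digit_word_iff)
qed

text \<open>Let \<open>b\<close> be the lower end point of the largest extension \<open>v\<close>. If \<open>\<beta>\<close> is larger than \<open>b\<close>, then \<open>\<beta>\<close>
  itself has digit word \<open>v\<close>: for \<open>\<beta>\<close> below the base of \<open>v\<close> because the bases of a word form an
  interval, for \<open>\<beta>\<close> above it because \<open>v\<close> is maximal. Between \<open>b\<close> and \<open>\<beta>\<close> the remainders then drift
  apart by at least \<open>\<beta>\<^sup>k (\<beta> - b) x\<close>, yet they stay below \<open>1\<close>.\<close>

lemma beta_lower_max_ext_ge:
  assumes "0 < x" and "x \<le> 1" and "u \<noteq> []" and "\<beta> \<in> cylinder x u"
  shows "\<beta> - 1 / (\<beta> ^ k * x) \<le> beta_lower x (max_ext x u k)"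
proof -
  let ?N = "length u + k" and ?v = "max_ext x u k"
  obtain \<beta>' where \<beta>': "\<beta>' \<in> cylinder x u" "?v = digit_word ?N x \<beta>'"
    and max: "digit_word ?N x \<beta> \<le> ?v"
    using max_ext_greatest[OF assms] by blast
  have gt: "1 < \<beta>'" "1 < \<beta>" using \<beta>'(1) assms(4) by (auto simp: cylinder_def)
  let ?b = "beta_lower x ?v"
  note lower = expansion_beta_lower[OF assms(1,2) gt(1) \<beta>'(2)]
  have "(\<beta> - ?b) * (\<beta> ^ k * x) \<le> 1"
  proof (cases "?b \<le> \<beta>")
    case True
    have eq: "digit_word ?N x \<beta> = ?v"
    proof (cases "\<beta> \<le> \<beta>'")
      case True
      then show ?thesis
        using digit_word_between_beta_lower_and_base[OF assms(1,2) gt(1) \<beta>'(2)] \<open>?b \<le> \<beta>\<close> by simp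
    next
      case False
      then have "?v \<le> digit_word ?N x \<beta>"
        unfolding \<beta>'(2) using assms(1) gt by (intro digit_word_mono_base) auto
      with max show ?thesis by simp
    qed
    \<comment> \<open>\<open>u\<close> contributes at least one letter, which pays for the first step in the drift estimate.\<close>
    obtain l where l: "?N = Suc l" "k \<le> l" using assms(3) by (cases u) auto
    have "\<beta> ^ k \<le> \<beta> ^ l" using l(2) gt(2) by (simp add: power_increasing)
    then have "(\<beta> - ?b) * x * \<beta> ^ k \<le> (\<beta> - ?b) * x * \<beta> ^ l"
      using assms(1) \<open>?b \<le> \<beta>\<close> by (intro mult_left_mono) auto
    also have "\<dots> \<le> remainder x ?v ?b (Suc l) + \<beta> ^ l * (\<beta> - ?b) * x"
      using remainder_nonneg_above_beta_lower[OF assms(1,2) gt(1) \<beta>'(2) order_refl, of "Suc l"] l(1)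
      by (simp add: mult_ac)
    also have "\<dots> \<le> remainder x ?v \<beta> (Suc l)"
      using remainder_nonneg_above_beta_lower[OF assms(1,2) gt(1) \<beta>'(2) order_refl] l(1)
        lower(1) \<open>?b \<le> \<beta>\<close>
      by (intro remainder_gap) auto
    also have "\<dots> < 1"
      using eq l(1) digit_word_eq_iff[of ?N x \<beta> ?v] by (simp del: remainder.simps)
    finally show ?thesis by (simp add: mult_ac)
  next
    case False
    then have "(\<beta> - ?b) * (\<beta> ^ k * x) \<le> 0"
      using assms(1) gt(2) by (intro mult_nonpos_nonneg) auto
    then show ?thesis by simp
  qed
  then show ?thesis using assms(1) gt(2) by (simp add: field_simps)
qed

text \<open>The lower end points of the largest extensions never exceed the supremum, because each is at most
  some base of \<open>u\<close>, and eventually they exceed every number below it by the previous estimate.\<close>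

lemma beta_upper_eq_Sup_cylinder:
  assumes "0 < x" and "x \<le> 1" and "u \<noteq> []" and ne: "cylinder x u \<noteq> {}"
  shows "beta_upper x u = Sup (cylinder x u)"
proof -
  let ?S = "Sup (cylinder x u)"
  have bdd: "bdd_above (cylinder x u)" by (rule bdd_above_cylinder[OF assms(1,3)])
  have "(\<lambda>k. beta_lower x (max_ext x u k)) \<longlonglongrightarrow> ?S"
  proof (rule order_tendstoI)
    fix a assume "a < ?S"
    then obtain \<beta> where \<beta>: "\<beta> \<in> cylinder x u" "a < \<beta>"
      using less_cSup_iff[OF ne bdd] by blast
    then have "1 < \<beta>" by (simp add: cylinder_def)
    then have "(\<lambda>k. inverse (\<beta> ^ k)) \<longlonglongrightarrow> 0"
      by (rule LIMSEQ_inverse_realpow_zero)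
    then have "(\<lambda>k. inverse x * inverse (\<beta> ^ k)) \<longlonglongrightarrow> 0"
      by (rule tendsto_mult_right_zero)
    then have "(\<lambda>k. \<beta> - inverse x * inverse (\<beta> ^ k)) \<longlonglongrightarrow> \<beta> - 0"
      by (intro tendsto_intros)
    then have "\<forall>\<^sub>F k in sequentially. a < \<beta> - inverse x * inverse (\<beta> ^ k)"
      using \<beta>(2) by (intro order_tendstoD(1)) auto
    then show "\<forall>\<^sub>F k in sequentially. a < beta_lower x (max_ext x u k)"
    proof eventually_elim
      case (elim k)
      then show ?case
        using beta_lower_max_ext_ge[OF assms(1-3) \<beta>(1), of k]
        by (simp add: divide_inverse inverse_mult_distrib mult.commute)
    qed
  next
    fix a assume a: "?S < a"
    obtain \<beta> where \<beta>: "\<beta> \<in> cylinder x u" using ne by blast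
    have "beta_lower x (max_ext x u k) < a" for k
    proof -
      obtain \<beta>' where \<beta>': "\<beta>' \<in> cylinder x u" "max_ext x u k = digit_word (length u + k) x \<beta>'"
        using max_ext_greatest[OF assms(1-3) \<beta>] by blast
      have "beta_lower x (max_ext x u k) \<le> \<beta>'"
        using \<beta>' by (intro expansion_beta_lower(2)[OF assms(1,2)]) (auto simp: cylinder_def)
      also have "\<dots> \<le> ?S" using \<beta>'(1) bdd by (rule cSup_upper)
      finally show ?thesis using a by simp
    qed
    then show "\<forall>\<^sub>F k in sequentially. beta_lower x (max_ext x u k) < a" by simp
  qed
  then show ?thesis unfolding beta_upper_def by (rule limI)
qed

theorem lemma4p1:
  fixes x :: real and n :: nat and w :: "int list"
  assumes "0 < x" and "x \<le> 1"
    and "n \<ge> 1"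
    and "w \<in> Omega_words n x"
  shows "beta_lower x w \<ge> 1
    \<and> (\<forall>\<beta>::real. \<beta> > beta_lower x w \<longrightarrow> w \<in> Sigma_words n \<beta>)
    \<and> (\<forall>u. u \<noteq> [] \<and> prefix u w \<longrightarrow> w \<in> Sigma_words n (beta_upper x u))"
proof -
  obtain \<beta> where \<beta>: "1 < \<beta>" "w = digit_word n x \<beta>"
    using assms(4) by (auto simp: Omega_words_def)
  note lower = expansion_beta_lower[OF assms(1,2) \<beta>]
  note above = word_in_Sigma_words_above_beta_lower[OF assms(1,2) \<beta>]
  have "beta_lower x w < beta_upper x u" if u: "u \<noteq> []" "prefix u w" for u
  proof -
    obtain \<beta>' where \<beta>': "\<beta> < \<beta>'" "digit_word n x \<beta>' = w"
      using cylinder_right_open[of x \<beta> n] assms(1) \<beta> by auto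
    obtain k where "n = length u + k"
      using prefix_length_le[OF u(2)] \<beta>(2) by (auto simp: le_iff_add)
    then have "\<beta>' \<in> cylinder x u"
      using \<beta>' u(2) \<beta>(1) prefix_digit_word_iff[of u k x \<beta>'] by (simp add: cylinder_def)
    then have "\<beta>' \<le> Sup (cylinder x u)" and "beta_upper x u = Sup (cylinder x u)"
      using bdd_above_cylinder[OF assms(1) u(1)] beta_upper_eq_Sup_cylinder[OF assms(1,2) u(1)]
      by (auto intro: cSup_upper)
    then show ?thesis using lower(2) \<beta>'(1) by simp
  qed
  then show ?thesis using lower(1) above by blast
qed

end
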